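(* Let $h>0$, let $A$ and $B$ be two relatively prime real polynomials and let $(a,b)$, $-\infty\le a<b\le+\infty$, be an interval in which $1+B/A>0$. Let $\phi$ be the external field on $(a,b)$ with force $F_\phi=-\phi'=\frac{1}{2h}\log\left(1+\frac{B}{A}\right)$. (i) If a distribution of points $a<x_1<x_2<\dots<x_n<b$ is a critical distribution under the external field $\phi$ in $(a,b)$, then the polynomial $p(x)=(x-x_1)\cdots(x-x_n)$ is a solution of the difference equation $$A\,\Delta_h\nabla_h y+B\,\Delta_h y+C\,y=0$$ for some polynomial $C$ of degree at most $\max(\deg(A)-2,\deg(B)-1)$. (ii) Conversely, if a polynomial $p$ is a solution of a difference equation $A\,\Delta_h\nabla_h y+B\,\Delta_h y+C\,y=0$ with $C$ a polynomial, and the roots of $p$ are simple, lie in $(a,b)$ and have mutual distances greater than $h$, then these roots form a critical distribution under the external field $\phi$ in $(a,b)$.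
   Context: Difference operators: $\Delta_h f(x)=f(x+h)-f(x)$ and $\nabla_h f(x)=f(x)-f(x-h)$, so $\Delta_h\nabla_h f(x)=f(x+h)-2f(x)+f(x-h)$. The force that a unit charge at $x\in\mathbb{R}$ exerts on a unit charge at $y$ is $$F_x(y)=\frac{1}{2h}\log\frac{y-x+h}{y-x-h},\qquad y\in\mathbb{R}\setminus[x-h,x+h].$$ The condition $1+B/A>0$ in $(a,b)$ means that the quotient is defined (so $A$ does not vanish in $(a,b)$) and that the inequality holds at every point of $(a,b)$. Critical distribution: a critical distribution under the external field $\phi$ in $(a,b)$ is a distribution $a<x_1<x_2<\dots<x_n<b$ with $x_{j+1}>x_j+h$ for $j=1,\dots,n-1$, such that $$\sum_{k=1,\,k\neq j}^n F_{x_k}(x_j)+F_\phi(x_j)=0,\qquad j=1,\dots,n.$$ Convention: a polynomial of degree at most a negative number is the zero polynomial. *)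

theory Defs
  imports "HOL-Analysis.Analysis" "HOL-Computational_Algebra.Computational_Algebra"
begin

definition fwd_diff :: "'a::ab_group_add \<Rightarrow> ('a \<Rightarrow> 'b::ab_group_add) \<Rightarrow> 'a \<Rightarrow> 'b" where
  "fwd_diff h f x = f (x + h) - f x"

definition bwd_diff :: "'a::ab_group_add \<Rightarrow> ('a \<Rightarrow> 'b::ab_group_add) \<Rightarrow> 'a \<Rightarrow> 'b" where
  "bwd_diff h f x = f x - f (x - h)"

text \<open>The polymorphism serves both real and complex polynomial solutions.\<close>

definition solves_difference_eq ::
    "'a::comm_ring_1 \<Rightarrow> 'a poly \<Rightarrow> 'a poly \<Rightarrow> 'a poly \<Rightarrow> ('a \<Rightarrow> 'a) \<Rightarrow> bool" where
  "solves_difference_eq h A B C y \<longleftrightarrow>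
     (\<forall>x. poly A x * fwd_diff h (bwd_diff h y) x + poly B x * fwd_diff h y x + poly C x * y x = 0)"

text \<open>The force on a unit charge at \<open>y\<close> exerted by a unit charge at \<open>x\<close>; it is meaningful only
  for \<open>y\<close> outside \<open>[x - h, x + h]\<close>, where the argument of the logarithm is positive.\<close>

definition charge_force :: "real \<Rightarrow> real \<Rightarrow> real \<Rightarrow> real" where
  "charge_force h x y = 1 / (2 * h) * ln ((y - x + h) / (y - x - h))"

definition field_force :: "(real \<Rightarrow> real) \<Rightarrow> real \<Rightarrow> real" where
  "field_force \<phi> x = - deriv \<phi> x"

text \<open>The points are \<open>x 1, \<dots>, x n\<close>; the empty distribution \<open>n = 0\<close> is admitted.\<close>

definition critical_distribution ::
    "real \<Rightarrow> (real \<Rightarrow> real) \<Rightarrow> ereal \<Rightarrow> ereal \<Rightarrow> nat \<Rightarrow> (nat \<Rightarrow> real) \<Rightarrow> bool" where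
  "critical_distribution h \<phi> a b n x \<longleftrightarrow>
     (\<forall>j\<in>{1..n}. x j \<in> einterval a b) \<and>
     strict_mono_on {1..n} x \<and>
     (\<forall>j\<in>{1..<n}. x (j + 1) > x j + h) \<and>
     (\<forall>j\<in>{1..n}. (\<Sum>k\<in>{1..n} - {j}. charge_force h (x k) (x j)) + field_force \<phi> (x j) = 0)"

text \<open>The bound may be negative, in which case only the zero polynomial qualifies.\<close>

definition degree_at_most :: "'a::zero poly \<Rightarrow> int \<Rightarrow> bool" where
  "degree_at_most p d \<longleftrightarrow> p = 0 \<or> int (degree p) \<le> d"

end

theory Submission
  imports Defs
begin

text \<open>For \<open>p = (x - x\<^sub>1) \<dots> (x - x\<^sub>n)\<close> the left-hand side of the difference equation is
  \<open>(A + B) p(x + h) + A p(x - h) - (2 A + B - C) p(x)\<close>. Multiplying the equilibrium condition at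
  \<open>x\<^sub>j\<close> by \<open>2 h\<close> and exponentiating it gives exactly
  \<open>(1 + B/A) p(x\<^sub>j + h) + p(x\<^sub>j - h) = 0\<close>, because the factor \<open>k = j\<close>
  of \<open>p(x\<^sub>j \<plusminus> h)\<close> is \<open>\<plusminus>h\<close>. So the distribution is critical iff \<open>p\<close> divides
  \<open>A \<Delta>\<nabla>p + B \<Delta>p\<close>, and the bound on \<open>C\<close> follows since each difference lowers the degree.\<close>

section \<open>Degree bounds by possibly negative integers\<close>

lemma degree_at_most_mono: "degree_at_most p d \<Longrightarrow> d \<le> e \<Longrightarrow> degree_at_most p e"
  by (auto simp: degree_at_most_def)

lemma degree_at_most_add:
  assumes "degree_at_most p d" "degree_at_most q d"
  shows "degree_at_most (p + q) d"
proof -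
  have "degree (p + q) \<le> max (degree p) (degree q)"
    by (rule degree_add_le_max)
  then show ?thesis
    using assms by (auto simp: degree_at_most_def)
qed

lemma degree_at_most_uminus_iff [simp]:
  fixes p :: "'a::ab_group_add poly"
  shows "degree_at_most (- p) d \<longleftrightarrow> degree_at_most p d"
  by (simp add: degree_at_most_def)

lemma degree_at_most_mult:
  fixes p q :: "'a::comm_semiring_0 poly"
  assumes "degree_at_most p d" "degree_at_most q e"
  shows "degree_at_most (p * q) (d + e)"
proof (cases "p = 0 \<or> q = 0")
  case False
  then show ?thesis
    using assms degree_mult_le[of p q] by (simp add: degree_at_most_def)
qed (auto simp: degree_at_most_def)

text \<open>Over a domain degrees add exactly, so a bound on the product passes to the factor. For
  negative \<open>d\<close> it forces \<open>q = 0\<close>, in accordance with the convention for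
  negative bounds.\<close>

lemma degree_at_most_mult_cancel:
  fixes p q :: "'a::idom poly"
  assumes "degree_at_most (p * q) (int (degree p) + d)" "p \<noteq> 0"
  shows "degree_at_most q d"
proof (cases "q = 0")
  case False
  then show ?thesis
    using assms by (simp add: degree_at_most_def degree_mult_eq)
qed (simp add: degree_at_most_def)

section \<open>Difference operators on polynomials\<close>

definition poly_diff :: "'a::comm_ring_1 \<Rightarrow> 'a poly \<Rightarrow> 'a poly" where
  "poly_diff h p = pcompose p [:h, 1:] - p"

lemma poly_poly_diff: "poly (poly_diff h p) x = fwd_diff h (poly p) x"
  by (simp add: poly_diff_def fwd_diff_def poly_pcompose add.commute)

text \<open>The backward difference with step \<open>h\<close> is minus the forward difference with
  step \<open>- h\<close>, so one operator and one degree lemma serve both.\<close>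

lemma poly_diff_second:
  "poly (- poly_diff h (poly_diff (- h) p)) x = fwd_diff h (bwd_diff h (poly p)) x"
  by (simp add: poly_poly_diff fwd_diff_def bwd_diff_def)

text \<open>A shift of the variable keeps degree and leading coefficient, so the top terms cancel. A
  constant has difference zero, which meets even a negative bound.\<close>

lemma degree_at_most_poly_diff:
  fixes p :: "'a::idom poly"
  assumes "degree_at_most p d"
  shows "degree_at_most (poly_diff h p) (d - 1)"
proof (cases "degree p = 0")
  case True
  then obtain c where "p = [:c:]"
    by (rule degree_eq_zeroE)
  then show ?thesis
    by (simp add: poly_diff_def degree_at_most_def)
next
  case False
  have deg: "degree (pcompose p [:h, 1:]) = degree p"
    by (simp add: degree_pcompose)
  have "lead_coeff (pcompose p [:h, 1:]) = lead_coeff p"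
    by (subst lead_coeff_comp) auto
  then have "coeff (poly_diff h p) (degree p) = 0"
    using deg by (simp add: poly_diff_def)
  moreover have "degree (poly_diff h p) \<le> degree p"
    unfolding poly_diff_def by (rule degree_diff_le) (simp_all add: deg)
  ultimately have "degree (poly_diff h p) < degree p"
    using False by (metis degree_0 eq_zero_or_degree_less gr0I)
  then show ?thesis
    using assms False by (auto simp: degree_at_most_def)
qed

section \<open>From vanishing at the points to a difference equation\<close>

lemma prod_linear_dvd:
  fixes q :: "'a::idom poly"
  assumes "finite S" "\<And>s. s \<in> S \<Longrightarrow> poly q s = 0"
  shows "(\<Prod>s\<in>S. [:- s, 1:]) dvd q"
  using assms
proof (induction S arbitrary: q rule: finite_induct)
  case (insert s S)
  then obtain r where r: "q = [:- s, 1:] * r"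
    by (metis insertI1 poly_eq_0_iff_dvd dvdE)
  \<comment> \<open>Since \<open>s\<close> is not in \<open>S\<close>, the factor
    \<open>t - s\<close> is nonzero and cancels in \<open>poly q t = 0\<close>; the induction
    hypothesis is then applied to \<open>r\<close> in place of \<open>q\<close>.\<close>
  have "poly r t = 0" if "t \<in> S" for t
    using insert.prems[of t] insert.hyps that by (auto simp: r)
  then have "(\<Prod>s\<in>S. [:- s, 1:]) dvd r"
    by (rule insert.IH)
  then show ?case
    unfolding r prod.insert[OF insert.hyps] by (rule mult_dvd_mono[OF dvd_refl])
qed simp

text \<open>By \<open>root\<close>, the equation without its \<open>C\<close> term holds at every
  zero of the product. The product therefore divides that expression, and minus the quotient serves
  as \<open>C\<close>.\<close>

lemma difference_eq_exists_multiplier: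
  fixes A B :: "real poly"
  assumes S: "finite S"
    and root: "\<And>s. s \<in> S \<Longrightarrow>
      (poly A s + poly B s) * (\<Prod>t\<in>S. s + h - t) + poly A s * (\<Prod>t\<in>S. s - h - t) = 0"
  shows "\<exists>C. degree_at_most C (max (int (degree A) - 2) (int (degree B) - 1)) \<and>
      solves_difference_eq h A B C (poly (\<Prod>s\<in>S. [:- s, 1:]))"
proof -
  define p where "p = (\<Prod>s\<in>S. [:- s, 1:])"
  define q where "q = A * (- poly_diff h (poly_diff (- h) p)) + B * poly_diff h p"
  have p_eval: "poly p x = (\<Prod>t\<in>S. x - t)" for x
    by (simp add: p_def poly_prod)
  have q_eval: "poly q x = poly A x * fwd_diff h (bwd_diff h (poly p)) x
      + poly B x * fwd_diff h (poly p) x" for x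
    unfolding q_def poly_add poly_mult poly_diff_second poly_poly_diff ..
  have "poly q s = 0" if s: "s \<in> S" for s
  proof -
    have "poly p s = 0"
      using s S by (auto simp: p_eval)
    then have "poly q s = (poly A s + poly B s) * poly p (s + h) + poly A s * poly p (s - h)"
      by (simp add: q_eval fwd_diff_def bwd_diff_def algebra_simps)
    then show ?thesis
      using root[OF s] by (simp add: p_eval)
  qed
  then have "p dvd q"
    unfolding p_def using S by (intro prod_linear_dvd)
  then obtain r where r: "q = p * r" ..
  let ?d = "max (int (degree A) - 2) (int (degree B) - 1)" and ?n = "int (degree p)"
  have diff: "degree_at_most (poly_diff c p) (?n - 1)" for c
    by (rule degree_at_most_poly_diff) (simp add: degree_at_most_def)
  \<comment> \<open>Two differences lower the degree of \<open>p\<close> by 2, one difference by 1;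
    cancelling \<open>?n\<close> afterwards leaves the two terms of \<open>?d\<close>.\<close>
  have "degree_at_most (A * (- poly_diff h (poly_diff (- h) p))) (int (degree A) + (?n - 1 - 1))"
    by (intro degree_at_most_mult degree_at_most_uminus_iff[THEN iffD2]
        degree_at_most_poly_diff diff) (simp add: degree_at_most_def)
  moreover have "degree_at_most (B * poly_diff h p) (int (degree B) + (?n - 1))"
    by (intro degree_at_most_mult diff) (simp add: degree_at_most_def)
  ultimately have "degree_at_most q (?n + ?d)"
    unfolding q_def by (intro degree_at_most_add) (erule degree_at_most_mono; simp)+
  moreover have "p \<noteq> 0"
    using S by (simp add: p_def)
  ultimately have "degree_at_most (- r) ?d"
    unfolding r by (simp add: degree_at_most_mult_cancel)
  moreover have "solves_difference_eq h A B (- r) (poly p)"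
    unfolding solves_difference_eq_def
  proof
    fix x
    show "poly A x * fwd_diff h (bwd_diff h (poly p)) x + poly B x * fwd_diff h (poly p) x
        + poly (- r) x * poly p x = 0"
      using q_eval[of x] by (simp add: r mult.commute)
  qed
  ultimately show ?thesis
    unfolding p_def by blast
qed

text \<open>The logarithms add up to \<open>ln (N / D * w)\<close>, which vanishes iff
  \<open>w * N = D\<close>. In the full products the factor \<open>s = t\<close> contributes
  \<open>h\<close> and \<open>- h\<close>, and this sign turns the equality into a vanishing
  sum.\<close>

lemma force_balance_iff:
  fixes h t w :: real
  assumes h: "h > 0" and w: "w > 0" and S: "finite S" "t \<in> S"
    and sep: "\<And>s. s \<in> S \<Longrightarrow> s \<noteq> t \<Longrightarrow> \<bar>t - s\<bar> > h"
  shows "(\<Sum>s\<in>S - {t}. charge_force h s t) + 1 / (2 * h) * ln w = 0 \<longleftrightarrow>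
    w * (\<Prod>s\<in>S. t + h - s) + (\<Prod>s\<in>S. t - h - s) = 0"
proof -
  define N where "N = (\<Prod>s\<in>S - {t}. t - s + h)"
  define D where "D = (\<Prod>s\<in>S - {t}. t - s - h)"
  \<comment> \<open>Separation gives numerator and denominator the same sign, also for charges to
    the right of \<open>t\<close>, where both are negative. Every logarithm thus has a positive
    argument.\<close>
  have quot: "(t - s + h) / (t - s - h) > 0" and nz: "t - s - h \<noteq> 0" if "s \<in> S - {t}" for s
    using sep[of s] that h by (auto simp: zero_less_divide_iff abs_if split: if_splits)
  have D: "D \<noteq> 0"
    using S nz by (simp add: D_def)
  have ND: "N / D = (\<Prod>s\<in>S - {t}. (t - s + h) / (t - s - h))"
    by (simp add: N_def D_def prod_dividef)
  have pos: "N / D > 0"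
    unfolding ND using quot by (rule prod_pos)
  have "(\<Sum>s\<in>S - {t}. ln ((t - s + h) / (t - s - h))) = ln (N / D)"
    unfolding ND by (rule ln_prod[symmetric]) (use S quot in force)+
  then have "(\<Sum>s\<in>S - {t}. charge_force h s t) + 1 / (2 * h) * ln w
      = 1 / (2 * h) * (ln (N / D) + ln w)"
    by (simp add: charge_force_def sum_distrib_left[symmetric] distrib_left del: times_divide_eq_left)
  also have "\<dots> = 1 / (2 * h) * ln (N / D * w)"
    using pos w by (simp only: ln_mult_pos)
  also have "\<dots> = 0 \<longleftrightarrow> N / D * w = 1"
    using h pos w by (metis ln_eq_zero_iff mult_pos_pos mult_eq_0_iff divide_eq_0_iff
        less_numeral_extra(3) zero_less_numeral zero_neq_one)
  also have "\<dots> \<longleftrightarrow> w * (h * N) + (- h) * D = 0"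
    using D h by (simp add: divide_simps) (simp add: mult.left_commute mult.commute)
  also have "h * N = (\<Prod>s\<in>S. t + h - s)"
    unfolding N_def using S by (subst (2) prod.remove[of _ t]) (auto simp: algebra_simps)
  also have "(- h) * D = (\<Prod>s\<in>S. t - h - s)"
    unfolding D_def using S by (subst (2) prod.remove[of _ t]) (auto simp: algebra_simps)
  finally show ?thesis .
qed

section \<open>Ordered points with gaps, and criticality in terms of the point set\<close>

lemma separated_points_dist:
  fixes h :: real and x :: "nat \<Rightarrow> real"
  assumes mono: "strict_mono_on {1..n} x" and gap: "\<forall>j\<in>{1..<n}. x (j + 1) > x j + h"
    and "j \<in> {1..n}" "k \<in> {1..n}" "j < k"
  shows "x k - x j > h"
proof -
  have "x (j + 1) \<le> x k"
    using assms(3-5) by (intro strict_mono_on_leD[OF mono]) auto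
  moreover have "x (j + 1) > x j + h"
    using gap assms(3-5) by auto
  ultimately show ?thesis
    by linarith
qed

lemma finite_set_increasing_enumeration:
  fixes T :: "'a::linorder set"
  assumes "finite T"
  obtains x where "x ` {1..card T} = T" "strict_mono_on {1..card T} x"
proof
  let ?l = "sorted_list_of_set T"
  \<comment> \<open>List positions start at 0, the points at 1.\<close>
  define x where "x k = ?l ! (k - 1)" for k
  have "x ` {1..card T} = x ` Suc ` {..<card T}"
    by (simp add: image_Suc_lessThan)
  also have "\<dots> = (!) ?l ` {..<card T}"
    by (simp add: x_def image_image)
  also have "\<dots> = set ?l"
    by (auto simp: set_conv_nth)
  finally show "x ` {1..card T} = T"
    using assms by simp
  show "strict_mono_on {1..card T} x"
    unfolding strict_mono_on_def x_def
    using sorted_wrt_nth_less[OF strict_sorted_list_of_set[of T]] by auto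
qed

text \<open>Serves both directions. The right-hand side depends on the points only through their
  set, which is the form in which the roots of a polynomial are given.\<close>

lemma critical_distribution_iff:
  fixes \<phi> :: "real \<Rightarrow> real" and A B :: "real poly"
  assumes h: "h > 0"
    and pos: "\<forall>y\<in>einterval a b. poly A y \<noteq> 0 \<and> 1 + poly B y / poly A y > 0"
    and deriv: "\<forall>y\<in>einterval a b.
      (\<phi> has_real_derivative - (1 / (2 * h) * ln (1 + poly B y / poly A y))) (at y)"
    and mono: "strict_mono_on {1..n} x"
    and gap: "\<forall>j\<in>{1..<n}. x (j + 1) > x j + h"
    and mem: "\<forall>j\<in>{1..n}. x j \<in> einterval a b"
  shows "critical_distribution h \<phi> a b n x \<longleftrightarrow>
    (\<forall>s\<in>x ` {1..n}. (poly A s + poly B s) * (\<Prod>t\<in>x ` {1..n}. s + h - t)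
      + poly A s * (\<Prod>t\<in>x ` {1..n}. s - h - t) = 0)"
proof -
  let ?S = "x ` {1..n}"
  have inj: "inj_on x {1..n}"
    using mono by (rule strict_mono_on_imp_inj_on)
  have "(\<Sum>k\<in>{1..n} - {j}. charge_force h (x k) (x j)) + field_force \<phi> (x j) = 0 \<longleftrightarrow>
      (poly A (x j) + poly B (x j)) * (\<Prod>t\<in>?S. x j + h - t)
        + poly A (x j) * (\<Prod>t\<in>?S. x j - h - t) = 0" if j: "j \<in> {1..n}" for j
  proof -
    let ?w = "1 + poly B (x j) / poly A (x j)"
    have A: "poly A (x j) \<noteq> 0" and w: "?w > 0"
      using pos mem j by auto
    have field: "field_force \<phi> (x j) = 1 / (2 * h) * ln ?w"
      unfolding field_force_def using deriv mem j by (metis DERIV_imp_deriv minus_minus)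
    have "x ` ({1..n} - {j}) = ?S - {x j}"
      using inj j by (subst inj_on_image_set_diff[OF inj]) auto
    then have sum: "(\<Sum>k\<in>{1..n} - {j}. charge_force h (x k) (x j))
        = (\<Sum>s\<in>?S - {x j}. charge_force h s (x j))"
      using sum.reindex[OF inj_on_subset[OF inj], of "{1..n} - {j}" "\<lambda>s. charge_force h s (x j)"]
      by simp
    have sep: "\<bar>x j - s\<bar> > h" if s: "s \<in> ?S" "s \<noteq> x j" for s
    proof -
      from s obtain k where k: "k \<in> {1..n}" "s = x k" "k \<noteq> j"
        by blast
      then show ?thesis
        using separated_points_dist[OF mono gap, of j k] separated_points_dist[OF mono gap, of k j] j
        by (cases "j < k") auto
    qed
    have "(\<Sum>k\<in>{1..n} - {j}. charge_force h (x k) (x j)) + field_force \<phi> (x j) = 0 \<longleftrightarrow>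
        ?w * (\<Prod>t\<in>?S. x j + h - t) + (\<Prod>t\<in>?S. x j - h - t) = 0"
      unfolding sum field using h w j sep by (intro force_balance_iff) auto
    \<comment> \<open>Multiplying by the nonzero value of \<open>A\<close> clears the denominator in
      \<open>?w\<close>.\<close>
    also have "\<dots> \<longleftrightarrow> poly A (x j) *
        (?w * (\<Prod>t\<in>?S. x j + h - t) + (\<Prod>t\<in>?S. x j - h - t)) = 0"
      using A by simp
    also have "poly A (x j) * (?w * (\<Prod>t\<in>?S. x j + h - t) + (\<Prod>t\<in>?S. x j - h - t))
        = (poly A (x j) * ?w) * (\<Prod>t\<in>?S. x j + h - t) + poly A (x j) * (\<Prod>t\<in>?S. x j - h - t)"
      by (subst distrib_left) (simp only: mult.assoc)
    also have "poly A (x j) * ?w = poly A (x j) + poly B (x j)"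
      using A by (simp add: distrib_left)
    finally show ?thesis .
  qed
  then show ?thesis
    unfolding critical_distribution_def using mono gap mem by simp
qed

text \<open>A complex polynomial with simple real roots is its leading coefficient times a real
  product. At a real root the complex equation is therefore this coefficient times a real
  expression, and the coefficient cancels.\<close>

lemma complex_difference_eq_at_root:
  fixes p C :: "complex poly" and A B :: "real poly" and T :: "real set"
  assumes eq: "solves_difference_eq (of_real h) (map_poly of_real A) (map_poly of_real B) C (poly p)"
    and p: "p \<noteq> 0"
    and simple: "\<forall>z. poly p z = 0 \<longrightarrow> order z p = 1"
    and T: "{z. poly p z = 0} = of_real ` T"
    and t: "t \<in> T"
  shows "(poly A t + poly B t) * (\<Prod>s\<in>T. t + h - s) + poly A t * (\<Prod>s\<in>T. t - h - s) = 0"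
proof -
  have map_eval: "poly (map_poly of_real q) (of_real y) = (of_real (poly q y) :: complex)"
    for q :: "real poly" and y
    by (induction q) (simp_all add: map_poly_pCons)
  have "p = smult (lead_coeff p) (\<Prod>z\<in>of_real ` T. [:- z, 1:] ^ order z p)"
    using complex_poly_decompose[of p] T by simp
  also have "(\<Prod>z\<in>of_real ` T. [:- z, 1:] ^ order z p) = (\<Prod>z\<in>of_real ` T. [:- z, 1:])"
    using simple unfolding T[symmetric] by (intro prod.cong) auto
  also have "\<dots> = (\<Prod>s\<in>T. [:- of_real s, 1:])"
    by (subst prod.reindex) (auto simp: inj_on_def)
  finally have decomp: "p = smult (lead_coeff p) (\<Prod>s\<in>T. [:- of_real s, 1:])" .
  have p_eval: "poly p (of_real y) = lead_coeff p * of_real (\<Prod>s\<in>T. y - s)" for y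
    by (subst decomp) (simp add: poly_prod)
  have root: "poly p (of_real t) = 0"
    using T t by auto
  \<comment> \<open>At the root \<open>t\<close> the term with \<open>C\<close> vanishes, whatever
    the value of \<open>C\<close> there.\<close>
  have "0 = of_real (poly A t) * fwd_diff (of_real h) (bwd_diff (of_real h) (poly p)) (of_real t)
      + of_real (poly B t) * fwd_diff (of_real h) (poly p) (of_real t)"
    using eq root unfolding solves_difference_eq_def by (metis map_eval mult_zero_right add_0_right)
  also have "\<dots> = of_real (poly A t + poly B t) * poly p (of_real (t + h))
      + of_real (poly A t) * poly p (of_real (t - h))"
    using root by (simp add: fwd_diff_def bwd_diff_def algebra_simps)
  also have "\<dots> = lead_coeff p * of_real
      ((poly A t + poly B t) * (\<Prod>s\<in>T. t + h - s) + poly A t * (\<Prod>s\<in>T. t - h - s))"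
    unfolding p_eval by (simp only: of_real_add of_real_mult distrib_left mult_ac)
  finally show ?thesis
    using p by (metis leading_coeff_0_iff mult_eq_0_iff of_real_eq_0_iff)
qed

theorem theorem2p4:
  fixes h :: real and A B :: "real poly" and a b :: ereal and \<phi> :: "real \<Rightarrow> real"
  assumes "h > 0"
    and "coprime A B"
    and "a < b"
    and "\<forall>x\<in>einterval a b. poly A x \<noteq> 0 \<and> 1 + poly B x / poly A x > 0"
    and "\<forall>x\<in>einterval a b.
           (\<phi> has_real_derivative - (1 / (2 * h) * ln (1 + poly B x / poly A x))) (at x)"
  shows "(\<forall>n x. critical_distribution h \<phi> a b n x \<longrightarrow>
            (\<exists>C :: real poly.
               degree_at_most C (max (int (degree A) - 2) (int (degree B) - 1)) \<and>
               solves_difference_eq h A B C (poly (\<Prod>k=1..n. [:- x k, 1:]))))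
       \<and> (\<forall>p C :: complex poly.
            solves_difference_eq (of_real h) (map_poly of_real A) (map_poly of_real B) C (poly p) \<longrightarrow>
            (\<forall>z. poly p z = 0 \<longrightarrow> order z p = 1) \<longrightarrow>
            {z. poly p z = 0} \<subseteq> of_real ` einterval a b \<longrightarrow>
            (\<forall>z w. poly p z = 0 \<longrightarrow> poly p w = 0 \<longrightarrow> z \<noteq> w \<longrightarrow> dist z w > h) \<longrightarrow>
            (\<exists>n x. critical_distribution h \<phi> a b n x \<and>
                   of_real ` x ` {1..n} = {z. poly p z = 0}))"
proof (intro conjI allI impI)
  fix n x
  assume crit: "critical_distribution h \<phi> a b n x"
  then have mono: "strict_mono_on {1..n} x" and gap: "\<forall>j\<in>{1..<n}. x (j + 1) > x j + h"
    and mem: "\<forall>j\<in>{1..n}. x j \<in> einterval a b"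
    by (simp_all add: critical_distribution_def)
  have "(poly A s + poly B s) * (\<Prod>t\<in>x ` {1..n}. s + h - t)
      + poly A s * (\<Prod>t\<in>x ` {1..n}. s - h - t) = 0" if "s \<in> x ` {1..n}" for s
    using critical_distribution_iff[OF assms(1,4,5) mono gap mem] crit that by blast
  then have "\<exists>C. degree_at_most C (max (int (degree A) - 2) (int (degree B) - 1)) \<and>
      solves_difference_eq h A B C (poly (\<Prod>s\<in>x ` {1..n}. [:- s, 1:]))"
    by (intro difference_eq_exists_multiplier) auto
  \<comment> \<open>The points are distinct, so the product over their set equals the product over
    the indices.\<close>
  then show "\<exists>C. degree_at_most C (max (int (degree A) - 2) (int (degree B) - 1)) \<and>
      solves_difference_eq h A B C (poly (\<Prod>k=1..n. [:- x k, 1:]))"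
    using strict_mono_on_imp_inj_on[OF mono] by (simp add: prod.reindex)
next
  fix p C :: "complex poly"
  assume eq: "solves_difference_eq (of_real h) (map_poly of_real A) (map_poly of_real B) C (poly p)"
    and simple: "\<forall>z. poly p z = 0 \<longrightarrow> order z p = 1"
    and sub: "{z. poly p z = 0} \<subseteq> of_real ` einterval a b"
    and sep: "\<forall>z w. poly p z = 0 \<longrightarrow> poly p w = 0 \<longrightarrow> z \<noteq> w \<longrightarrow> dist z w > h"
  \<comment> \<open>The zero polynomial would vanish at \<open>\<i>\<close>, whereas all roots are
    real.\<close>
  have p: "p \<noteq> 0"
  proof
    assume "p = 0"
    then have "\<i> \<in> of_real ` einterval a b"
      using sub by auto
    then show False
      by (auto simp: complex_eq_iff)
  qed
  \<comment> \<open>A nonzero constant \<open>p\<close> has empty \<open>T\<close> and yields the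
    empty distribution.\<close>
  define T where "T = {t :: real. poly p (of_real t) = 0}"
  have T: "{z. poly p z = 0} = of_real ` T"
    using sub by (auto simp: T_def)
  have "finite T"
    using poly_roots_finite[OF p] unfolding T by (rule finite_imageD) (simp add: inj_on_def)
  then obtain x where x: "x ` {1..card T} = T" and mono: "strict_mono_on {1..card T} x"
    by (rule finite_set_increasing_enumeration)
  have x_root: "poly p (of_real (x j)) = 0" if "j \<in> {1..card T}" for j
    using x that unfolding T_def by blast
  have gap: "\<forall>j\<in>{1..<card T}. x (j + 1) > x j + h"
  proof
    fix j assume j: "j \<in> {1..<card T}"
    then have less: "x j < x (j + 1)"
      by (intro strict_mono_onD[OF mono]) auto
    \<comment> \<open>The embedding of the reals preserves distances, and the order of the two
      points removes the absolute value.\<close>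
    then have "dist (of_real (x j) :: complex) (of_real (x (j + 1))) > h"
      using x_root[of j] x_root[of "j + 1"] j by (intro sep[rule_format]) auto
    then show "x (j + 1) > x j + h"
      using less by (simp add: dist_of_real dist_real_def)
  qed
  have mem: "\<forall>j\<in>{1..card T}. x j \<in> einterval a b"
    using sub x_root by fastforce
  have "critical_distribution h \<phi> a b (card T) x"
    unfolding critical_distribution_iff[OF assms(1,4,5) mono gap mem] x
    using complex_difference_eq_at_root[OF eq p simple T] by blast
  then show "\<exists>n x. critical_distribution h \<phi> a b n x \<and> of_real ` x ` {1..n} = {z. poly p z = 0}"
    using x T by metis
qed

end
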